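(* Let $\gamma$ be an interval equipped with a Riemannian metric (so $n=\dim\gamma=1$). Let $\mathfrak H$ be the Lie algebra generated under the Poisson bracket by the functions $H_f(x,w)=-2\sqrt{1-\|w\|^2}\,f(x)$ on $T_{<1}\gamma=\{(x,w)\in T\gamma:\|w\|<1\}$, $f\in C^\infty(\gamma)$. Then, written in the coordinates $(s,y)$, $y=\frac{w}{\sqrt{1-w^2}}$, $$\mathfrak H=\bigoplus_{k\ge0}\Lambda_k .$$
   Context: Let $s$ be the natural (length) parameter on $\gamma$; it trivializes $T\gamma$, so tangent vectors $w$ become real numbers and $T_{<1}\gamma=\gamma\times(-1,1)$ with coordinates $(s,w)$ and symplectic form $dw\wedge ds$, with Poisson bracket $\{F,G\}=\frac{\partial F}{\partial w}\frac{\partial G}{\partial s}-\frac{\partial F}{\partial s}\frac{\partial G}{\partial w}$. Functions of $(s,w)$ are rewritten as functions of $(s,y)\in\gamma\times\mathbb R$, $y=\frac{w}{\sqrt{1-w^2}}$ (the Poisson bracket being transported accordingly). For $k\in\mathbb Z_{\ge0}$ and $h\in C^\infty(\gamma)$ set $H_{k,h}(s,y)=\frac{h(s)y^k}{\sqrt{1+y^2}}$ and $\Lambda_k=\{H_{k,h}: h\in C^\infty(\gamma)\}$. In these coordinates $H_f=-2H_{0,f}$. The direct sum consists of finite sums. *)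

theory Defs
  imports "HOL-Analysis.Analysis"
begin

text \<open>
  An interval \<open>\<gamma>\<close> with a Riemannian metric is given by a nondegenerate real interval \<open>I\<close>
  (open, closed or half-open, bounded or not), with coordinate \<open>x\<close>, and a metric \<open>q(x) dx\<^sup>2\<close>.
  A tangent vector at \<open>x\<close> is a real number \<open>v\<close> (meaning \<open>v d/dx\<close>), so \<open>T\<gamma>\<close> is the set of pairs
  \<open>(x, v)\<close> with \<open>x \<in> I\<close>.

  A function on a subset of the plane is represented by its extension by \<open>0\<close> to the whole plane,
  so that equality of functions on the subset is equality in HOL.
\<close>

text \<open>\<open>C\<^sup>\<infinity>\<close> on an interval, with one-sided derivatives at endpoints that belong to it.\<close>

definition smooth_on_interval :: "real set \<Rightarrow> (real \<Rightarrow> real) \<Rightarrow> bool" where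
  "smooth_on_interval I f \<longleftrightarrow>
     (\<exists>D :: nat \<Rightarrow> real \<Rightarrow> real. (\<forall>x\<in>I. D 0 x = f x) \<and>
        (\<forall>n. \<forall>x\<in>I. (D n has_real_derivative D (Suc n) x) (at x within I)))"

definition nondegenerate_interval :: "real set \<Rightarrow> bool" where
  "nondegenerate_interval I \<longleftrightarrow> is_interval I \<and> interior I \<noteq> {}"

definition riemannian_metric :: "real set \<Rightarrow> (real \<Rightarrow> real) \<Rightarrow> bool" where
  "riemannian_metric I q \<longleftrightarrow> smooth_on_interval I q \<and> (\<forall>x\<in>I. q x > 0)"

definition tangent_norm :: "(real \<Rightarrow> real) \<Rightarrow> real \<times> real \<Rightarrow> real" where
  "tangent_norm q = (\<lambda>(x, v). sqrt (q x * v\<^sup>2))"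

definition unit_disc_bundle :: "real set \<Rightarrow> (real \<Rightarrow> real) \<Rightarrow> (real \<times> real) set" where
  "unit_disc_bundle I q = {(x, v). x \<in> I \<and> tangent_norm q (x, v) < 1}"

text \<open>The arc length parameter, determined up to an additive constant: \<open>d/ds\<close> has unit norm.\<close>

definition natural_parameter :: "real set \<Rightarrow> (real \<Rightarrow> real) \<Rightarrow> (real \<Rightarrow> real) \<Rightarrow> bool" where
  "natural_parameter I q \<sigma> \<longleftrightarrow>
     (\<forall>x\<in>I. (\<sigma> has_real_derivative sqrt (q x)) (at x within I))"

text \<open>
  The chart \<open>(x, v) \<mapsto> (s, w)\<close> from \<open>T\<gamma>\<close> to \<open>\<sigma> ` I \<times> \<real>\<close> (the vector \<open>v d/dx\<close> is \<open>w d/ds\<close>),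
  and its inverse.
\<close>

definition to_sw :: "(real \<Rightarrow> real) \<Rightarrow> (real \<Rightarrow> real) \<Rightarrow> real \<times> real \<Rightarrow> real \<times> real" where
  "to_sw q \<sigma> = (\<lambda>(x, v). (\<sigma> x, sqrt (q x) * v))"

definition of_sw ::
  "real set \<Rightarrow> (real \<Rightarrow> real) \<Rightarrow> (real \<Rightarrow> real) \<Rightarrow> real \<times> real \<Rightarrow> real \<times> real" where
  "of_sw I q \<sigma> = (\<lambda>(s, w). let x = inv_into I \<sigma> s in (x, w / sqrt (q x)))"

text \<open>
  The Poisson bracket of \<open>dw \<and> ds\<close> on \<open>J \<times> (-1, 1)\<close>. The derivative in \<open>s\<close> is taken within \<open>J\<close>,
  hence one-sided at endpoints.
\<close>

definition partial_s :: "real set \<Rightarrow> (real \<times> real \<Rightarrow> real) \<Rightarrow> real \<times> real \<Rightarrow> real" where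
  "partial_s J F = (\<lambda>(s, w). vector_derivative (\<lambda>s'. F (s', w)) (at s within J))"

definition partial_w :: "(real \<times> real \<Rightarrow> real) \<Rightarrow> real \<times> real \<Rightarrow> real" where
  "partial_w F = (\<lambda>(s, w). vector_derivative (\<lambda>w'. F (s, w')) (at w))"

definition bracket_sw ::
  "real set \<Rightarrow> (real \<times> real \<Rightarrow> real) \<Rightarrow> (real \<times> real \<Rightarrow> real) \<Rightarrow> real \<times> real \<Rightarrow> real" where
  "bracket_sw J F G =
     (\<lambda>p. partial_w F p * partial_s J G p - partial_s J F p * partial_w G p)"

definition poisson_bracket ::
  "real set \<Rightarrow> (real \<Rightarrow> real) \<Rightarrow> (real \<Rightarrow> real) \<Rightarrow>
   (real \<times> real \<Rightarrow> real) \<Rightarrow> (real \<times> real \<Rightarrow> real) \<Rightarrow> real \<times> real \<Rightarrow> real" where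
  "poisson_bracket I q \<sigma> F G =
     (\<lambda>p. if p \<in> unit_disc_bundle I q
          then bracket_sw (\<sigma> ` I) (F \<circ> of_sw I q \<sigma>) (G \<circ> of_sw I q \<sigma>) (to_sw q \<sigma> p)
          else 0)"

definition linear_subspace :: "('a \<Rightarrow> real) set \<Rightarrow> bool" where
  "linear_subspace V \<longleftrightarrow>
     (\<lambda>p. 0) \<in> V \<and>
     (\<forall>F\<in>V. \<forall>G\<in>V. (\<lambda>p. F p + G p) \<in> V) \<and>
     (\<forall>F\<in>V. \<forall>c. (\<lambda>p. c * F p) \<in> V)"

text \<open>The least linear subspace that contains \<open>S\<close> and is closed under the bracket \<open>br\<close>.\<close>

inductive_set lie_algebra_generated ::
  "(('a \<Rightarrow> real) \<Rightarrow> ('a \<Rightarrow> real) \<Rightarrow> 'a \<Rightarrow> real) \<Rightarrow> ('a \<Rightarrow> real) set \<Rightarrow> ('a \<Rightarrow> real) set"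
  for br :: "('a \<Rightarrow> real) \<Rightarrow> ('a \<Rightarrow> real) \<Rightarrow> 'a \<Rightarrow> real" and S :: "('a \<Rightarrow> real) set" where
  generator: "F \<in> S \<Longrightarrow> F \<in> lie_algebra_generated br S"
| zero: "(\<lambda>p. 0) \<in> lie_algebra_generated br S"
| add: "\<lbrakk>F \<in> lie_algebra_generated br S; G \<in> lie_algebra_generated br S\<rbrakk>
    \<Longrightarrow> (\<lambda>p. F p + G p) \<in> lie_algebra_generated br S"
| scale: "F \<in> lie_algebra_generated br S \<Longrightarrow> (\<lambda>p. c * F p) \<in> lie_algebra_generated br S"
| bracket: "\<lbrakk>F \<in> lie_algebra_generated br S; G \<in> lie_algebra_generated br S\<rbrakk>
    \<Longrightarrow> br F G \<in> lie_algebra_generated br S"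

definition hamiltonian :: "real set \<Rightarrow> (real \<Rightarrow> real) \<Rightarrow> (real \<Rightarrow> real) \<Rightarrow> real \<times> real \<Rightarrow> real" where
  "hamiltonian I q f =
     (\<lambda>p. if p \<in> unit_disc_bundle I q
          then - 2 * sqrt (1 - (tangent_norm q p)\<^sup>2) * f (fst p) else 0)"

definition lie_algebra_H ::
  "real set \<Rightarrow> (real \<Rightarrow> real) \<Rightarrow> (real \<Rightarrow> real) \<Rightarrow> (real \<times> real \<Rightarrow> real) set" where
  "lie_algebra_H I q \<sigma> =
     lie_algebra_generated (poisson_bracket I q \<sigma>)
       {hamiltonian I q f | f. smooth_on_interval I f}"

lemma y_of_w_inverse:
  fixes w y :: real
  shows "\<bar>w\<bar> < 1 \<Longrightarrow> y = w / sqrt (1 - w\<^sup>2) \<longleftrightarrow> w = y / sqrt (1 + y\<^sup>2)"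
proof
  assume w: "\<bar>w\<bar> < 1"
  have p: "0 < 1 - w\<^sup>2" using w by (simp add: abs_square_less_1)
  { assume y: "y = w / sqrt (1 - w\<^sup>2)"
    have "1 + y\<^sup>2 = 1 / (1 - w\<^sup>2)" using p by (simp add: y power_divide field_simps)
    then have "sqrt (1 + y\<^sup>2) = 1 / sqrt (1 - w\<^sup>2)" by (simp add: real_sqrt_divide)
    then show "w = y / sqrt (1 + y\<^sup>2)" using p by (simp add: y) }
  { assume w': "w = y / sqrt (1 + y\<^sup>2)"
    have q: "0 < 1 + y\<^sup>2" by (simp add: add_pos_nonneg)
    have "1 - w\<^sup>2 = 1 / (1 + y\<^sup>2)" using q by (simp add: w' power_divide field_simps)
    then have "sqrt (1 - w\<^sup>2) = 1 / sqrt (1 + y\<^sup>2)" by (simp add: real_sqrt_divide)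
    then show "y = w / sqrt (1 - w\<^sup>2)" using q by (simp add: w') }
qed

text \<open>
  A function on the unit disc bundle, written in the coordinates \<open>(s, y) \<in> \<sigma> ` I \<times> \<real>\<close>;
  \<open>w = y / sqrt (1 + y\<^sup>2)\<close> inverts \<open>y = w / sqrt (1 - w\<^sup>2)\<close>.
\<close>

definition in_sy_coords ::
  "real set \<Rightarrow> (real \<Rightarrow> real) \<Rightarrow> (real \<Rightarrow> real) \<Rightarrow>
   (real \<times> real \<Rightarrow> real) \<Rightarrow> real \<times> real \<Rightarrow> real" where
  "in_sy_coords I q \<sigma> F =
     (\<lambda>(s, y). if s \<in> \<sigma> ` I then F (of_sw I q \<sigma> (s, y / sqrt (1 + y\<^sup>2))) else 0)"

text \<open>For \<open>h\<close> a function on \<open>\<gamma>\<close>, \<open>h(s)\<close> is its value at the point with natural parameter \<open>s\<close>.\<close>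

definition H_sy ::
  "real set \<Rightarrow> (real \<Rightarrow> real) \<Rightarrow> nat \<Rightarrow> (real \<Rightarrow> real) \<Rightarrow> real \<times> real \<Rightarrow> real" where
  "H_sy I \<sigma> k h =
     (\<lambda>(s, y). if s \<in> \<sigma> ` I then h (inv_into I \<sigma> s) * y ^ k / sqrt (1 + y\<^sup>2) else 0)"

lemma hamiltonian_in_sy_coords:
  assumes "riemannian_metric I q"
  shows "in_sy_coords I q \<sigma> (hamiltonian I q f) = (\<lambda>p. - 2 * H_sy I \<sigma> 0 f p)"
proof
  fix p :: "real \<times> real"
  obtain s y where p: "p = (s, y)" by (cases p)
  have r: "0 < 1 + y\<^sup>2" by (simp add: add_pos_nonneg)
  show "in_sy_coords I q \<sigma> (hamiltonian I q f) p = - 2 * H_sy I \<sigma> 0 f p"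
  proof (cases "s \<in> \<sigma> ` I")
    case True
    define x where "x = inv_into I \<sigma> s"
    have x: "x \<in> I" using True by (simp add: x_def inv_into_into)
    have qx: "0 < q x" using assms x by (simp add: riemannian_metric_def)
    have n: "q x * (y / sqrt (1 + y\<^sup>2) / sqrt (q x))\<^sup>2 = y\<^sup>2 / (1 + y\<^sup>2)"
      using qx r by (simp add: power_divide power_mult_distrib)
    have l: "y\<^sup>2 / (1 + y\<^sup>2) < 1" "0 \<le> y\<^sup>2 / (1 + y\<^sup>2)" using r by simp_all
    have e: "1 - y\<^sup>2 / (1 + y\<^sup>2) = 1 / (1 + y\<^sup>2)" using r by (simp add: field_simps)
    have sq: "sqrt (1 - (sqrt (y\<^sup>2 / (1 + y\<^sup>2)))\<^sup>2) = 1 / sqrt (1 + y\<^sup>2)"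
      unfolding real_sqrt_pow2[OF l(2)] e by (simp add: real_sqrt_divide)
    have nm: "tangent_norm q (x, y / sqrt (1 + y\<^sup>2) / sqrt (q x)) = sqrt (y\<^sup>2 / (1 + y\<^sup>2))"
      by (simp only: tangent_norm_def prod.case n)
    have mem: "(x, y / sqrt (1 + y\<^sup>2) / sqrt (q x)) \<in> unit_disc_bundle I q"
      unfolding unit_disc_bundle_def mem_Collect_eq prod.case nm using x real_sqrt_less_mono[OF l(1)] by (simp only: real_sqrt_one simp_thms)
    have "hamiltonian I q f (x, y / sqrt (1 + y\<^sup>2) / sqrt (q x)) = - 2 * (1 / sqrt (1 + y\<^sup>2)) * f x"
      unfolding hamiltonian_def if_P[OF mem] nm sq fst_conv ..
    then show ?thesis
      using True by (simp add: p in_sy_coords_def of_sw_def H_sy_def Let_def flip: x_def)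
  qed (auto simp: p in_sy_coords_def H_sy_def)
qed

definition Lambda :: "real set \<Rightarrow> (real \<Rightarrow> real) \<Rightarrow> nat \<Rightarrow> (real \<times> real \<Rightarrow> real) set" where
  "Lambda I \<sigma> k = {H_sy I \<sigma> k h | h. smooth_on_interval I h}"

text \<open>\<open>V\<close> is the (algebraic) internal direct sum of the linear subspaces \<open>L k\<close>.\<close>

definition is_direct_sum :: "('a \<Rightarrow> real) set \<Rightarrow> ('i \<Rightarrow> ('a \<Rightarrow> real) set) \<Rightarrow> bool" where
  "is_direct_sum V L \<longleftrightarrow>
     (\<forall>k. linear_subspace (L k)) \<and>
     V = {(\<lambda>p. \<Sum>k\<in>K. u k p) | K u. finite K \<and> (\<forall>k\<in>K. u k \<in> L k)} \<and>
     (\<forall>K u. finite K \<longrightarrow> (\<forall>k\<in>K. u k \<in> L k) \<longrightarrow> (\<lambda>p. \<Sum>k\<in>K. u k p) = (\<lambda>p. 0) \<longrightarrow>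
        (\<forall>k\<in>K. u k = (\<lambda>p. 0)))"

end

theory Submission
  imports Defs
begin

text \<open>
  Write \<open>r = sqrt (1 - w\<^sup>2)\<close> and \<open>y = w / r\<close>. On the fibre the function \<open>y\<^sup>k / sqrt (1 + y\<^sup>2)\<close> is
  \<open>E k = y\<^sup>k r\<close>, and since \<open>dy/dw = 1 / r\<^sup>3\<close> and \<open>1 / r\<^sup>2 = 1 + y\<^sup>2\<close>, its derivative in \<open>w\<close> is a
  polynomial in \<open>y\<close>: \<open>E k' = k y\<^bsup>k-1\<^esup> + (k - 1) y\<^bsup>k+1\<^esup>\<close>. Hence \<open>E k' E l\<close> is again a combination of
  the functions \<open>E j\<close> (\<open>fibre_weight_deriv_mult_fibre_weight\<close>), and with primes on
  coefficients for \<open>d/ds\<close>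
  \<open>{f E k, g E l} = (k f g' - l f' g) E (k+l-1) + ((k-1) f g' - (l-1) f' g) E (k+l+1)\<close>.
  So the finite sums of functions \<open>h E k\<close> are closed under the bracket and contain every
  \<open>H_f = -2 f E 0\<close>; this bounds the Lie algebra from above.

  For the reverse inclusion take \<open>l = 0\<close> and \<open>g = 1\<close>: the formula collapses to
  \<open>{f E k, E 0} = f' E (k+1)\<close> (\<open>poisson_bracket_monomial_one\<close>). On an interval every smooth function
  is the \<open>s\<close>-derivative of a smooth function, so all of degree \<open>k + 1\<close> is obtained from degree \<open>k\<close>,
  and induction starts with the generators. The sum is direct because for fixed \<open>s\<close> a relation
  between the summands says that a polynomial in \<open>y\<close> vanishes identically.

  The analytic input is that \<open>f' = (df/dx) / sqrt q\<close> is smooth when \<open>f\<close> is, that smooth functions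
  on an interval with or without endpoints have smooth antiderivatives, and that \<open>\<sigma>\<close> has a
  differentiable inverse on \<open>\<sigma> ` I\<close>.
\<close>

section \<open>Smooth functions on an interval\<close>

text \<open>
  A family of functions that can be differentiated without leaving the family consists of smooth
  functions, since differentiation can be iterated. This avoids formulas for higher derivatives.
\<close>
lemma smooth_on_interval_coinduct:
  assumes "f \<in> S"
    and step: "\<And>g. g \<in> S \<Longrightarrow> \<exists>g'\<in>S. \<forall>x\<in>I. (g has_real_derivative g' x) (at x within I)"
  shows "smooth_on_interval I f"
proof -
  obtain d where d: "\<And>g. g \<in> S \<Longrightarrow> d g \<in> S"
      "\<And>g x. g \<in> S \<Longrightarrow> x \<in> I \<Longrightarrow> (g has_real_derivative d g x) (at x within I)"
    using step by metis
  have "(d ^^ n) f \<in> S" for n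
    by (induction n) (auto simp: assms(1) d(1))
  then show ?thesis
    unfolding smooth_on_interval_def by (intro exI[of _ "\<lambda>n. (d ^^ n) f"]) (auto intro: d(2))
qed

lemma smooth_on_interval_has_smooth_derivative:
  assumes "smooth_on_interval I f"
  obtains f' where "smooth_on_interval I f'"
    "\<And>x. x \<in> I \<Longrightarrow> (f has_real_derivative f' x) (at x within I)"
proof -
  obtain D where D0: "\<And>x. x \<in> I \<Longrightarrow> D 0 x = f x"
    and D: "\<And>n x. x \<in> I \<Longrightarrow> (D n has_real_derivative D (Suc n) x) (at x within I)"
    using assms unfolding smooth_on_interval_def by blast
  have "smooth_on_interval I (D 1)"
    unfolding smooth_on_interval_def by (intro exI[of _ "\<lambda>n. D (Suc n)"]) (auto intro: D)
  moreover have "(f has_real_derivative D 1 x) (at x within I)" if "x \<in> I" for x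
    by (rule has_field_derivative_transform_within[where f="D 0" and d=1]) 
       (use D[of x 0] D0 that in \<open>auto simp del: One_nat_def simp: One_nat_def[symmetric]\<close>)
  ultimately show thesis using that by blast
qed

lemma smooth_on_interval_const: "smooth_on_interval I (\<lambda>x. c)"
  by (rule smooth_on_interval_coinduct[where S="range (\<lambda>c x. c)"])
     (auto intro!: exI[of _ 0])

text \<open>
  The smooth functions with the functions in \<open>R\<close> adjoined. With \<open>R\<close> empty it serves to prove
  closure of smoothness under ring operations; with \<open>R = {1 / sqrt q}\<close> it gives smoothness of
  \<open>1 / sqrt q\<close>.
\<close>
inductive_set differential_algebra :: "real set \<Rightarrow> (real \<Rightarrow> real) set \<Rightarrow> (real \<Rightarrow> real) set"
  for I R where
  smooth: "smooth_on_interval I f \<Longrightarrow> f \<in> differential_algebra I R"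
| adjoined: "r \<in> R \<Longrightarrow> r \<in> differential_algebra I R"
| add: "\<lbrakk>f \<in> differential_algebra I R; g \<in> differential_algebra I R\<rbrakk>
    \<Longrightarrow> (\<lambda>x. f x + g x) \<in> differential_algebra I R"
| mult: "\<lbrakk>f \<in> differential_algebra I R; g \<in> differential_algebra I R\<rbrakk>
    \<Longrightarrow> (\<lambda>x. f x * g x) \<in> differential_algebra I R"

text \<open>
  By the sum and product rules it is enough to differentiate the adjoined functions inside the
  algebra; coinduction does the rest.
\<close>
lemma differential_algebra_smooth:
  assumes R: "\<And>r. r \<in> R \<Longrightarrow>
      \<exists>r'\<in>differential_algebra I R. \<forall>x\<in>I. (r has_real_derivative r' x) (at x within I)"
    and "f \<in> differential_algebra I R"
  shows "smooth_on_interval I f"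
proof (rule smooth_on_interval_coinduct[OF assms(2)])
  fix g assume "g \<in> differential_algebra I R"
  then show "\<exists>g'\<in>differential_algebra I R. \<forall>x\<in>I. (g has_real_derivative g' x) (at x within I)"
  proof induction
    case (smooth f)
    then show ?case
      by (metis smooth_on_interval_has_smooth_derivative differential_algebra.smooth)
  next
    case (adjoined r)
    then show ?case by (rule R)
  next
    case (add f g)
    then obtain f' g' where "f' \<in> differential_algebra I R" "g' \<in> differential_algebra I R"
      "\<And>x. x \<in> I \<Longrightarrow> (f has_real_derivative f' x) (at x within I)"
      "\<And>x. x \<in> I \<Longrightarrow> (g has_real_derivative g' x) (at x within I)" by blast
    then show ?case
      by (intro bexI[of _ "\<lambda>x. f' x + g' x"])
         (auto intro: differential_algebra.add DERIV_add)
  next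
    case (mult f g)
    then obtain f' g' where "f' \<in> differential_algebra I R" "g' \<in> differential_algebra I R"
      "\<And>x. x \<in> I \<Longrightarrow> (f has_real_derivative f' x) (at x within I)"
      "\<And>x. x \<in> I \<Longrightarrow> (g has_real_derivative g' x) (at x within I)" by blast
    with mult.hyps show ?case
      by (intro bexI[of _ "\<lambda>x. f' x * g x + g' x * f x"])
         (auto intro: differential_algebra.add differential_algebra.mult DERIV_mult)
  qed
qed

lemma smooth_on_interval_add:
  "\<lbrakk>smooth_on_interval I f; smooth_on_interval I g\<rbrakk> \<Longrightarrow> smooth_on_interval I (\<lambda>x. f x + g x)"
  by (rule differential_algebra_smooth[where R="{}"])
     (auto intro: differential_algebra.intros)

lemma smooth_on_interval_mult:
  "\<lbrakk>smooth_on_interval I f; smooth_on_interval I g\<rbrakk> \<Longrightarrow> smooth_on_interval I (\<lambda>x. f x * g x)"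
  by (rule differential_algebra_smooth[where R="{}"])
     (auto intro: differential_algebra.intros)

text \<open>
  The function \<open>r = 1 / sqrt q\<close> satisfies \<open>r' = - (1/2) q' r\<^sup>3\<close>, so adjoining it gives an algebra closed
  under differentiation.
\<close>
lemma smooth_on_interval_inverse_sqrt:
  assumes q: "smooth_on_interval I q" and pos: "\<And>x. x \<in> I \<Longrightarrow> q x > 0"
  shows "smooth_on_interval I (\<lambda>x. inverse (sqrt (q x)))"
proof -
  define r where "r = (\<lambda>x. inverse (sqrt (q x)))"
  obtain q' where q': "smooth_on_interval I q'"
    and dq: "\<And>x. x \<in> I \<Longrightarrow> (q has_real_derivative q' x) (at x within I)"
    using smooth_on_interval_has_smooth_derivative[OF q] by blast
  have dr: "(r has_real_derivative (- 1 / 2 * q' x) * (r x * (r x * r x))) (at x within I)"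
    if "x \<in> I" for x
    unfolding r_def using pos[OF that]
    by (auto intro!: derivative_eq_intros DERIV_chain2[OF DERIV_real_sqrt] dq that
             simp: field_simps power2_eq_square)
  have "(\<lambda>x. (- 1 / 2 * q' x) * (r x * (r x * r x))) \<in> differential_algebra I {r}"
    by (intro differential_algebra.mult differential_algebra.adjoined differential_algebra.smooth
          q' smooth_on_interval_const singletonI)
  then have "\<exists>r'\<in>differential_algebra I {r}. \<forall>x\<in>I. (r has_real_derivative r' x) (at x within I)"
    by (rule rev_bexI) (use dr in blast)
  then have "smooth_on_interval I r"
    by (intro differential_algebra_smooth[where R="{r}"])
       (auto intro: differential_algebra.adjoined)
  then show ?thesis by (simp add: r_def)
qed

lemma smooth_on_interval_sqrt:
  assumes q: "smooth_on_interval I q" and pos: "\<And>x. x \<in> I \<Longrightarrow> q x > 0"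
  shows "smooth_on_interval I (\<lambda>x. sqrt (q x))"
proof -
  have *: "smooth_on_interval I (\<lambda>x. q x * inverse (sqrt (q x)))"
    by (intro smooth_on_interval_mult smooth_on_interval_inverse_sqrt assms)
  moreover have "q x * inverse (sqrt (q x)) = sqrt (q x)" if "x \<in> I" for x
    using pos[OF that] by (simp add: real_div_sqrt flip: divide_inverse)
  ultimately show ?thesis
    unfolding smooth_on_interval_def by simp
qed

lemma smooth_on_interval_continuous_on:
  assumes "smooth_on_interval I f" shows "continuous_on I f"
  using smooth_on_interval_has_smooth_derivative[OF assms] DERIV_continuous_on by metis

text \<open>
  The integral from a base point \<open>c\<close> works. The derivative at \<open>x\<close> within \<open>I\<close> is computed on a compact
  interval \<open>{a..b}\<close> in \<open>I\<close> that contains \<open>c\<close> and is a neighbourhood of \<open>x\<close> relative to \<open>I\<close>: the choice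
  \<open>a = x\<close> or \<open>b = x\<close> is made only when \<open>x\<close> is an endpoint of \<open>I\<close>.
\<close>
lemma continuous_on_interval_has_antiderivative:
  fixes g :: "real \<Rightarrow> real"
  assumes I: "is_interval I" and g: "continuous_on I g"
  obtains f where "\<forall>x\<in>I. (f has_real_derivative g x) (at x within I)"
proof (cases "I = {}")
  case False
  then obtain c where c: "c \<in> I" by blast
  \<comment> \<open>At most one of the two intervals is nondegenerate: this is the oriented integral from \<open>c\<close> to \<open>x\<close>.\<close>
  define f where "f x = integral {c..x} g - integral {x..c} g" for x
  have "(f has_real_derivative g x) (at x within I)" if x: "x \<in> I" for x
  proof -
    obtain a where a: "a \<in> I" "a \<le> x" "a \<le> c" "a = x \<Longrightarrow> \<forall>t\<in>I. x \<le> t"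
    proof (cases "\<exists>t\<in>I. t < x")
      case True
      then obtain t where "t \<in> I" "t < x" by blast
      then show thesis by (intro that[of "min t c"]) (use c in \<open>auto simp: min_def\<close>)
    next
      case False
      then show thesis using that[of x] x c by force
    qed
    obtain b where b: "b \<in> I" "x \<le> b" "c \<le> b" "b = x \<Longrightarrow> \<forall>t\<in>I. t \<le> x"
    proof (cases "\<exists>t\<in>I. t > x")
      case True
      then obtain t where "t \<in> I" "t > x" by blast
      then show thesis by (intro that[of "max t c"]) (use c in \<open>auto simp: max_def\<close>)
    next
      case False
      then show thesis using that[of x] x c by force
    qed
    have sub: "{a..b} \<subseteq> I"
      using mem_is_interval_1_I[OF I a(1) b(1)] by auto
    have cont: "continuous_on {a..b} g" using g sub continuous_on_subset by blast
    have int: "g integrable_on {u..v}" if "a \<le> u" "v \<le> b" for u v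
      by (intro integrable_continuous_interval continuous_on_subset[OF cont]) (use that in auto)
    have f_eq: "f t = integral {a..t} g - integral {a..c} g" if "t \<in> {a..b}" for t
    proof (cases "c \<le> t")
      case True
      have "integral {a..c} g + integral {c..t} g = integral {a..t} g"
        by (rule Henstock_Kurzweil_Integration.integral_combine) (use True a that int in auto)
      moreover have "integral {t..c} g = 0" using True by (cases "t = c") auto
      ultimately show ?thesis by (simp add: f_def)
    next
      case False
      have "integral {a..t} g + integral {t..c} g = integral {a..c} g"
        by (rule Henstock_Kurzweil_Integration.integral_combine) (use False b that int in auto)
      then show ?thesis using False by (simp add: f_def)
    qed
    have "((\<lambda>t. integral {a..t} g - integral {a..c} g) has_real_derivative g x) (at x within {a..b})"
      using DERIV_diff[OF integral_has_real_derivative[OF cont, of x] DERIV_const] a b by auto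
    then have *: "(f has_real_derivative g x) (at x within {a..b})"
      by (rule has_field_derivative_transform_within[where d=1]) (use a b f_eq in auto)
    \<comment> \<open>A neighbourhood of \<open>x\<close> that leaves \<open>{a..b}\<close> only on sides where \<open>I\<close> has ended.\<close>
    define U where "U = (if a = x then {..<x+1} else {a<..}) \<inter> (if b = x then {x-1<..} else {..<b})"
    have U: "open U" "x \<in> U"
      using a(2) b(2) by (auto simp: U_def)
    have "t \<in> {a..b}" if "t \<in> U" "t \<in> I" for t
      using that a(4) b(4) by (cases "a = x"; cases "b = x") (auto simp: U_def intro: order.antisym)
    then have "at x within I = at x within {a..b}"
      by (intro at_within_nhd[OF U(2,1)]) (use sub in auto)
    then show ?thesis using * by simp
  qed
  then show thesis using that by blast
qed (use that in auto)

lemma smooth_on_interval_antiderivative: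
  assumes "is_interval I" and g: "smooth_on_interval I g"
  obtains f where "smooth_on_interval I f"
    "\<And>x. x \<in> I \<Longrightarrow> (f has_real_derivative g x) (at x within I)"
proof -
  obtain f where f: "\<forall>x\<in>I. (f has_real_derivative g x) (at x within I)"
    using continuous_on_interval_has_antiderivative[OF assms(1)
        smooth_on_interval_continuous_on[OF g]] by blast
  moreover have "smooth_on_interval I f"
  proof (rule smooth_on_interval_coinduct[where S="insert f {h. smooth_on_interval I h}"])
    fix h assume "h \<in> insert f {h. smooth_on_interval I h}"
    then consider "h = f" | "smooth_on_interval I h" by blast
    then show "\<exists>h'\<in>insert f {h. smooth_on_interval I h}.
        \<forall>x\<in>I. (h has_real_derivative h' x) (at x within I)"
    proof cases
      case 1
      then show ?thesis using f g by blast
    next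
      case 2
      then obtain h' where "smooth_on_interval I h'"
        "\<And>x. x \<in> I \<Longrightarrow> (h has_real_derivative h' x) (at x within I)"
        using smooth_on_interval_has_smooth_derivative by blast
      then show ?thesis by blast
    qed
  qed simp
  ultimately show thesis using that by blast
qed

section \<open>The fibre functions\<close>

text \<open>
  This is the coordinate \<open>y\<close> as a function of \<open>w\<close>.
\<close>
definition slope :: "real \<Rightarrow> real" where
  "slope w = w / sqrt (1 - w\<^sup>2)"

text \<open>
  This is \<open>y\<^sup>k / sqrt (1 + y\<^sup>2)\<close> as a function of \<open>w\<close>.
\<close>
definition fibre_weight :: "nat \<Rightarrow> real \<Rightarrow> real" where
  "fibre_weight k w = slope w ^ k * sqrt (1 - w\<^sup>2)"

definition fibre_weight_deriv :: "nat \<Rightarrow> real \<Rightarrow> real" where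
  "fibre_weight_deriv k w = real k * slope w ^ (k - 1) + (real k - 1) * slope w ^ (k + 1)"

text \<open>
  With \<open>r = sqrt (1 - w\<^sup>2)\<close> one has \<open>r' = - y\<close> and \<open>y' = (1 + y\<^sup>2) / r\<close>, so the factors \<open>r\<close> cancel in the
  derivative of \<open>y\<^sup>k r\<close>.
\<close>
lemma fibre_weight_has_derivative:
  assumes "\<bar>w\<bar> < 1"
  shows "(fibre_weight k has_real_derivative fibre_weight_deriv k w) (at w)"
proof -
  define r where "r = sqrt (1 - w\<^sup>2)"
  have pos: "0 < 1 - w\<^sup>2" using assms by (simp add: abs_square_less_1)
  then have r: "r > 0" "r\<^sup>2 = 1 - w\<^sup>2" by (simp_all add: r_def)
  have dr: "((\<lambda>w. sqrt (1 - w\<^sup>2)) has_real_derivative - slope w) (at w)"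
    using pos by (auto intro!: derivative_eq_intros DERIV_chain2[OF DERIV_real_sqrt]
                       simp: slope_def field_simps)
  have "(slope has_real_derivative (1 * r - w * - slope w) / (r * r)) (at w)"
    unfolding slope_def[abs_def] r_def
    by (rule DERIV_divide[OF DERIV_ident, unfolded slope_def]) (use dr pos in \<open>simp_all add: slope_def\<close>)
  moreover have "(1 * r - w * - slope w) / (r * r) = (1 + (slope w)\<^sup>2) / r"
    using r(1) by (simp add: slope_def field_simps power2_eq_square flip: r_def[unfolded power2_eq_square])
  ultimately have ds: "(slope has_real_derivative (1 + (slope w)\<^sup>2) / r) (at w)" by simp
  have "((\<lambda>w. slope w ^ k * sqrt (1 - w\<^sup>2)) has_real_derivative
      (real k * slope w ^ (k - 1) * ((1 + (slope w)\<^sup>2) / r)) * r + (- slope w) * slope w ^ k) (at w)"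
    using DERIV_mult[OF DERIV_chain2[OF DERIV_pow ds] dr] by (simp add: r_def)
  moreover have "(real k * slope w ^ (k - 1) * ((1 + (slope w)\<^sup>2) / r)) * r + (- slope w) * slope w ^ k
      = fibre_weight_deriv k w"
    using r(1) by (cases k) (simp_all add: fibre_weight_deriv_def field_simps power2_eq_square)
  ultimately show ?thesis by (simp add: fibre_weight_def[abs_def])
qed

text \<open>
  This identity makes the bracket preserve the span of the monomials. The truncated subtraction in
  \<open>k - 1\<close> is harmless, because for \<open>k = 0\<close> the coefficient of that term is \<open>0\<close>.
\<close>
lemma fibre_weight_deriv_mult_fibre_weight:
  "fibre_weight_deriv k w * fibre_weight l w =
     real k * fibre_weight (k - 1 + l) w + (real k - 1) * fibre_weight (k + 1 + l) w"
  by (simp add: fibre_weight_def fibre_weight_deriv_def power_add algebra_simps)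

lemma fibre_weight_in_y:
  "fibre_weight k (y / sqrt (1 + y\<^sup>2)) = y ^ k / sqrt (1 + y\<^sup>2)" "\<bar>y / sqrt (1 + y\<^sup>2)\<bar> < 1"
proof -
  define w where "w = y / sqrt (1 + y\<^sup>2)"
  have pos: "0 < 1 + y\<^sup>2" by (simp add: add_pos_nonneg)
  have w2: "1 - w\<^sup>2 = 1 / (1 + y\<^sup>2)"
    using pos by (simp add: w_def power_divide field_simps)
  have "0 < 1 - w\<^sup>2" using pos by (simp add: w2)
  then have w: "\<bar>w\<bar> < 1" by (simp add: abs_square_less_1)
  then have "slope w = y" using y_of_w_inverse[of w y] by (simp add: slope_def w_def)
  then show "fibre_weight k (y / sqrt (1 + y\<^sup>2)) = y ^ k / sqrt (1 + y\<^sup>2)"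
    by (simp add: fibre_weight_def w2 real_sqrt_divide flip: w_def)
  show "\<bar>y / sqrt (1 + y\<^sup>2)\<bar> < 1" using w by (simp add: w_def)
qed

section \<open>The arc length parameter\<close>

locale metric_interval =
  fixes I :: "real set" and q \<sigma> :: "real \<Rightarrow> real"
  assumes interval: "nondegenerate_interval I"
    and metric: "riemannian_metric I q"
    and parameter: "natural_parameter I q \<sigma>"
begin

lemma is_interval_I: "is_interval I"
  using interval by (simp add: nondegenerate_interval_def)

lemma I_not_singleton: "I \<noteq> {x}"
  using interval by (auto simp: nondegenerate_interval_def)

lemma q_pos: "x \<in> I \<Longrightarrow> q x > 0"
  using metric by (simp add: riemannian_metric_def)

lemma q_smooth: "smooth_on_interval I q"
  using metric by (simp add: riemannian_metric_def)

lemma parameter_derivative: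
  "x \<in> I \<Longrightarrow> (\<sigma> has_real_derivative sqrt (q x)) (at x within I)"
  using parameter by (simp add: natural_parameter_def)

lemma parameter_continuous: "continuous_on I \<sigma>"
  using parameter_derivative by (rule DERIV_continuous_on)

lemma parameter_less:
  assumes "x \<in> I" "y \<in> I" "x < y" shows "\<sigma> x < \<sigma> y"
proof -
  have sub: "{x..y} \<subseteq> I" using mem_is_interval_1_I[OF is_interval_I assms(1,2)] by auto
  have "\<exists>z\<in>{x<..<y}. \<sigma> y - \<sigma> x = sqrt (q z) * (y - x)"
    by (rule mvt_simple[OF assms(3)])
       (use sub in \<open>auto intro!: DERIV_subset[OF parameter_derivative, unfolded has_field_derivative_def]\<close>)
  then obtain z where z: "z \<in> {x<..<y}" "\<sigma> y - \<sigma> x = sqrt (q z) * (y - x)" ..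
  moreover have "z \<in> I" using z(1) sub by auto
  ultimately have "0 < \<sigma> y - \<sigma> x" using q_pos assms(3) by simp
  then show ?thesis by simp
qed

lemma parameter_inj: "inj_on \<sigma> I"
  by (rule linorder_inj_onI') (auto dest: parameter_less)

lemma inv_parameter [simp]: "x \<in> I \<Longrightarrow> inv_into I \<sigma> (\<sigma> x) = x"
  by (simp add: inv_into_f_f parameter_inj)

lemma inv_parameter_image: "inv_into I \<sigma> ` \<sigma> ` I = I"
  by (auto simp: image_image)

text \<open>
  An injective continuous function on an interval is a homeomorphism onto its image, so the inverse
  is continuous; the inverse function rule within a set then applies also at endpoints.
\<close>
lemma inv_parameter_derivative:
  assumes "x \<in> I"
  shows "(inv_into I \<sigma> has_real_derivative inverse (sqrt (q x))) (at (\<sigma> x) within \<sigma> ` I)"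
proof -
  have "path_connected I" using is_interval_I by (simp add: is_interval_path_connected)
  then obtain g where g: "homeomorphism I (\<sigma> ` I) \<sigma> g"
    using injective_into_1d_eq_homeomorphism parameter_continuous parameter_inj by blast
  have "continuous_on (\<sigma> ` I) (inv_into I \<sigma>)"
    using homeomorphism_cont2[OF g]
    by (rule continuous_on_eq) (use homeomorphism_apply1[OF g] in auto)
  then have cont: "continuous (at (\<sigma> x) within \<sigma> ` I) (inv_into I \<sigma>)"
    using assms by (simp add: continuous_on_eq_continuous_within)
  have nz: "sqrt (q x) \<noteq> 0" using q_pos[OF assms] by simp
  show ?thesis
    unfolding has_field_derivative_def
    by (rule has_derivative_inverse_within[OF
          parameter_derivative[OF assms, unfolded has_field_derivative_def] cont assms])
       (use nz in \<open>auto simp: linear_times fun_eq_iff\<close>)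
qed

definition arclength_derivative :: "(real \<Rightarrow> real) \<Rightarrow> (real \<Rightarrow> real) \<Rightarrow> bool" where
  "arclength_derivative f f' \<longleftrightarrow>
     (\<forall>x\<in>I. ((\<lambda>s. f (inv_into I \<sigma> s)) has_real_derivative f' x) (at (\<sigma> x) within \<sigma> ` I))"

lemma arclength_derivativeI:
  assumes "\<And>x. x \<in> I \<Longrightarrow> (f has_real_derivative f' x) (at x within I)"
  shows "arclength_derivative f (\<lambda>x. f' x * inverse (sqrt (q x)))"
  unfolding arclength_derivative_def
  using DERIV_image_chain[where s="\<sigma> ` I" and g="inv_into I \<sigma>" and f=f]
    inv_parameter_derivative assms
  by (simp add: inv_parameter_image o_def)

lemma smooth_has_arclength_derivative:
  assumes "smooth_on_interval I f"
  obtains f' where "smooth_on_interval I f'" "arclength_derivative f f'"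
proof -
  obtain f' where f': "smooth_on_interval I f'"
    "\<And>x. x \<in> I \<Longrightarrow> (f has_real_derivative f' x) (at x within I)"
    using smooth_on_interval_has_smooth_derivative[OF assms] by blast
  show thesis
    by (rule that[OF _ arclength_derivativeI[OF f'(2)]])
       (auto intro!: smooth_on_interval_mult f' smooth_on_interval_inverse_sqrt q_smooth q_pos)
qed

lemma smooth_family_has_arclength_derivatives:
  assumes "\<And>k. smooth_on_interval I (a k)"
  shows "\<exists>a'. \<forall>k. smooth_on_interval I (a' k) \<and> arclength_derivative (a k) (a' k)"
proof (rule choice, rule allI)
  fix k
  show "\<exists>f'. smooth_on_interval I f' \<and> arclength_derivative (a k) f'"
    using smooth_has_arclength_derivative[OF assms[of k]] by blast
qed

text \<open>
  This uses that the base is an interval: \<open>h sqrt q\<close> then has an antiderivative in \<open>x\<close>. On a circle \<open>h\<close>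
  would need mean value \<open>0\<close>.
\<close>
lemma smooth_is_arclength_derivative:
  assumes "smooth_on_interval I h"
  obtains f where "smooth_on_interval I f" "arclength_derivative f h"
proof -
  have "smooth_on_interval I (\<lambda>x. h x * sqrt (q x))"
    by (intro smooth_on_interval_mult assms smooth_on_interval_sqrt q_smooth q_pos)
  then obtain f where f: "smooth_on_interval I f"
    "\<And>x. x \<in> I \<Longrightarrow> (f has_real_derivative h x * sqrt (q x)) (at x within I)"
    using smooth_on_interval_antiderivative[OF is_interval_I] by blast
  have "h x * sqrt (q x) * inverse (sqrt (q x)) = h x" if "x \<in> I" for x
    using q_pos[OF that] by simp
  with arclength_derivativeI[OF f(2)] have "arclength_derivative f h"
    unfolding arclength_derivative_def by metis
  then show thesis using that f(1) by blast
qed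

section \<open>Monomials on the disc bundle and their brackets\<close>

text \<open>
  This is the function whose expression in \<open>(s, y)\<close> is \<open>H_sy I \<sigma> k h\<close>.
\<close>

definition monomial :: "nat \<Rightarrow> (real \<Rightarrow> real) \<Rightarrow> real \<times> real \<Rightarrow> real" where
  "monomial k h = (\<lambda>p. if p \<in> unit_disc_bundle I q
     then h (fst p) * fibre_weight k (sqrt (q (fst p)) * snd p) else 0)"

lemma tangent_norm_eq: "x \<in> I \<Longrightarrow> tangent_norm q (x, v) = \<bar>sqrt (q x) * v\<bar>"
  using q_pos[of x] by (simp add: tangent_norm_def real_sqrt_mult abs_mult)

lemma mem_unit_disc_bundle:
  "(x, v) \<in> unit_disc_bundle I q \<longleftrightarrow> x \<in> I \<and> \<bar>sqrt (q x) * v\<bar> < 1"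
  using tangent_norm_eq by (auto simp: unit_disc_bundle_def)

lemma monomial_of_sw:
  "x \<in> I \<Longrightarrow> monomial k h (of_sw I q \<sigma> (\<sigma> x, w)) = (if \<bar>w\<bar> < 1 then h x * fibre_weight k w else 0)"
  using q_pos[of x] by (simp add: monomial_def of_sw_def mem_unit_disc_bundle Let_def)

lemma in_sy_coords_monomial: "in_sy_coords I q \<sigma> (monomial k h) = H_sy I \<sigma> k h"
  by (auto simp: fun_eq_iff in_sy_coords_def H_sy_def monomial_of_sw fibre_weight_in_y(1)
        fibre_weight_in_y(2)[simplified])

lemma hamiltonian_eq_monomial: "hamiltonian I q f = monomial 0 (\<lambda>x. - 2 * f x)"
  by (auto simp: fun_eq_iff hamiltonian_def monomial_def mem_unit_disc_bundle tangent_norm_eq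
        fibre_weight_def)

text \<open>
  Uniqueness of derivatives within \<open>\<sigma> ` I\<close> needs every point to be a limit point; this holds because
  \<open>\<sigma> ` I\<close> is connected and has more than one point.
\<close>
lemma at_parameter_nontrivial:
  assumes "x \<in> I" shows "at (\<sigma> x) within \<sigma> ` I \<noteq> bot"
proof -
  have "connected (\<sigma> ` I)"
    using parameter_continuous is_interval_I connected_continuous_image is_interval_connected by blast
  moreover have "\<sigma> ` I \<noteq> {s}" for s
  proof
    assume "\<sigma> ` I = {s}"
    then have "I = {inv_into I \<sigma> s}" using inv_parameter_image by simp
    then show False using I_not_singleton by blast
  qed
  ultimately have "\<sigma> x islimpt \<sigma> ` I"
    using assms by (intro connected_imp_perfect) auto
  then show ?thesis by (simp add: trivial_limit_within)
qed

lemma partial_s_sum_monomial: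
  assumes x: "x \<in> I" and w: "\<bar>w\<bar> < 1" and a': "\<And>k. k \<in> K \<Longrightarrow> arclength_derivative (a k) (a' k)"
  shows "partial_s (\<sigma> ` I) ((\<lambda>p. \<Sum>k\<in>K. monomial k (a k) p) \<circ> of_sw I q \<sigma>) (\<sigma> x, w) =
    (\<Sum>k\<in>K. a' k x * fibre_weight k w)"
proof -
  have "((\<lambda>s. \<Sum>k\<in>K. a k (inv_into I \<sigma> s) * fibre_weight k w) has_real_derivative
      (\<Sum>k\<in>K. a' k x * fibre_weight k w)) (at (\<sigma> x) within \<sigma> ` I)"
    using a' x by (intro DERIV_sum DERIV_cmult_right) (auto simp: arclength_derivative_def)
  then have "((\<lambda>s. \<Sum>k\<in>K. monomial k (a k) (of_sw I q \<sigma> (s, w))) has_real_derivative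
      (\<Sum>k\<in>K. a' k x * fibre_weight k w)) (at (\<sigma> x) within \<sigma> ` I)"
    by (rule has_field_derivative_transform_within[where d=1]) (use x w in \<open>auto simp: monomial_of_sw\<close>)
  then show ?thesis
    using at_parameter_nontrivial[OF x]
    by (simp add: partial_s_def vector_derivative_within has_real_derivative_iff_has_vector_derivative)
qed

lemma partial_w_sum_monomial:
  assumes x: "x \<in> I" and w: "\<bar>w\<bar> < 1"
  shows "partial_w ((\<lambda>p. \<Sum>k\<in>K. monomial k (a k) p) \<circ> of_sw I q \<sigma>) (\<sigma> x, w) =
    (\<Sum>k\<in>K. a k x * fibre_weight_deriv k w)"
proof -
  have "((\<lambda>w. \<Sum>k\<in>K. a k x * fibre_weight k w) has_real_derivative
      (\<Sum>k\<in>K. a k x * fibre_weight_deriv k w)) (at w)"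
    using w by (intro DERIV_sum DERIV_cmult fibre_weight_has_derivative)
  then have "((\<lambda>w. \<Sum>k\<in>K. monomial k (a k) (of_sw I q \<sigma> (\<sigma> x, w))) has_real_derivative
      (\<Sum>k\<in>K. a k x * fibre_weight_deriv k w)) (at w)"
    by (rule has_field_derivative_transform_within_open[where S="{-1<..<1}"])
       (use x w in \<open>auto simp: monomial_of_sw abs_less_iff intro!: sum.cong\<close>)
  then show ?thesis
    by (simp add: partial_w_def vector_derivative_at has_real_derivative_iff_has_vector_derivative)
qed

text \<open>
  The bracket is defined by derivatives, which are additive only on differentiable functions.
  The formula is therefore computed directly for finite sums of monomials, where the derivatives of
  both arguments are known, and not deduced from bilinearity.
\<close>
lemma poisson_bracket_sum_monomial:
  assumes a': "\<And>k. k \<in> K \<Longrightarrow> arclength_derivative (a k) (a' k)"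
    and b': "\<And>l. l \<in> L \<Longrightarrow> arclength_derivative (b l) (b' l)"
  shows "poisson_bracket I q \<sigma> (\<lambda>p. \<Sum>k\<in>K. monomial k (a k) p) (\<lambda>p. \<Sum>l\<in>L. monomial l (b l) p) =
    (\<lambda>p. \<Sum>k\<in>K. \<Sum>l\<in>L.
        monomial (k - 1 + l) (\<lambda>x. real k * (a k x * b' l x)) p +
        monomial (k + 1 + l) (\<lambda>x. (real k - 1) * (a k x * b' l x)) p +
        monomial (l - 1 + k) (\<lambda>x. - real l * (a' k x * b l x)) p +
        monomial (l + 1 + k) (\<lambda>x. (1 - real l) * (a' k x * b l x)) p)"
    (is "poisson_bracket I q \<sigma> ?F ?G = ?R")
proof
  fix p :: "real \<times> real"
  obtain x v where p: "p = (x, v)" by (cases p)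
  show "poisson_bracket I q \<sigma> ?F ?G p = ?R p"
  proof (cases "p \<in> unit_disc_bundle I q")
    case False
    then show ?thesis by (simp add: poisson_bracket_def monomial_def)
  next
    case True
    define w where "w = sqrt (q x) * v"
    have x: "x \<in> I" and w: "\<bar>w\<bar> < 1" using True by (auto simp: p mem_unit_disc_bundle w_def)
    have m: "monomial k h p = h x * fibre_weight k w" for k h
      using True by (simp add: monomial_def) (simp add: p w_def)
    have product: "a k x * fibre_weight_deriv k w * (b' l x * fibre_weight l w)
        - a' k x * fibre_weight k w * (b l x * fibre_weight_deriv l w)
      = monomial (k - 1 + l) (\<lambda>x. real k * (a k x * b' l x)) p +
        monomial (k + 1 + l) (\<lambda>x. (real k - 1) * (a k x * b' l x)) p +
        monomial (l - 1 + k) (\<lambda>x. - real l * (a' k x * b l x)) p +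
        monomial (l + 1 + k) (\<lambda>x. (1 - real l) * (a' k x * b l x)) p" (is "?l = ?r") for k l
    proof -
      have "?l = a k x * b' l x * (fibre_weight_deriv k w * fibre_weight l w)
          - a' k x * b l x * (fibre_weight_deriv l w * fibre_weight k w)" by (simp add: algebra_simps)
      also have "\<dots> = ?r"
        unfolding fibre_weight_deriv_mult_fibre_weight m by algebra
      finally show ?thesis .
    qed
    have "to_sw q \<sigma> p = (\<sigma> x, w)" by (simp add: to_sw_def p w_def)
    then have "poisson_bracket I q \<sigma> ?F ?G p =
        (\<Sum>k\<in>K. a k x * fibre_weight_deriv k w) * (\<Sum>l\<in>L. b' l x * fibre_weight l w)
        - (\<Sum>k\<in>K. a' k x * fibre_weight k w) * (\<Sum>l\<in>L. b l x * fibre_weight_deriv l w)"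
      using True partial_s_sum_monomial[OF x w a'] partial_s_sum_monomial[OF x w b']
      by (simp add: poisson_bracket_def bracket_sw_def partial_w_sum_monomial[OF x w])
    also have "\<dots> = ?R p"
      unfolding sum_product sum_subtractf[symmetric] product ..
    finally show ?thesis .
  qed
qed

section \<open>The generated Lie algebra\<close>

definition monomial_sums :: "(real \<times> real \<Rightarrow> real) set" where
  "monomial_sums = {\<lambda>p. \<Sum>k\<in>K. monomial k (a k) p | K a. finite K \<and> (\<forall>k. smooth_on_interval I (a k))}"

lemma monomial_sumsI:
  "\<lbrakk>finite K; \<And>k. smooth_on_interval I (a k)\<rbrakk> \<Longrightarrow> (\<lambda>p. \<Sum>k\<in>K. monomial k (a k) p) \<in> monomial_sums"
  unfolding monomial_sums_def by blast

lemma monomial_mem_monomial_sums: "smooth_on_interval I h \<Longrightarrow> monomial k h \<in> monomial_sums"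
  using monomial_sumsI[of "{k}" "\<lambda>_. h"] by simp

lemma zero_mem_monomial_sums: "(\<lambda>p. 0) \<in> monomial_sums"
  using monomial_sumsI[of "{}" "\<lambda>_ x. 0"] smooth_on_interval_const by simp

lemma add_mem_monomial_sums:
  assumes "F \<in> monomial_sums" "G \<in> monomial_sums"
  shows "(\<lambda>p. F p + G p) \<in> monomial_sums"
proof -
  obtain K a where K: "finite K" "\<And>k. smooth_on_interval I (a k)"
    and F: "F = (\<lambda>p. \<Sum>k\<in>K. monomial k (a k) p)"
    using assms(1) unfolding monomial_sums_def by blast
  obtain L b where L: "finite L" "\<And>l. smooth_on_interval I (b l)"
    and G: "G = (\<lambda>p. \<Sum>l\<in>L. monomial l (b l) p)"
    using assms(2) unfolding monomial_sums_def by blast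
  \<comment> \<open>Both sums are rewritten over \<open>K \<union> L\<close>, with coefficient \<open>0\<close> in the missing degrees.\<close>
  define c where "c k = (\<lambda>x. (if k \<in> K then a k x else 0) + (if k \<in> L then b k x else 0))" for k
  have c: "smooth_on_interval I (c k)" for k
    unfolding c_def using K(2) L(2) smooth_on_interval_const[of I 0]
    by (intro smooth_on_interval_add) (cases "k \<in> K"; cases "k \<in> L"; simp)+
  have "monomial k (c k) p =
      (if k \<in> K then monomial k (a k) p else 0) + (if k \<in> L then monomial k (b k) p else 0)" for k p
    by (simp add: monomial_def c_def algebra_simps)
  moreover have "(K \<union> L) \<inter> K = K" "(K \<union> L) \<inter> L = L" by auto
  ultimately have "(\<lambda>p. F p + G p) = (\<lambda>p. \<Sum>k\<in>K \<union> L. monomial k (c k) p)"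
    using K(1) L(1) by (simp add: F G sum.distrib flip: sum.inter_restrict)
  then show ?thesis using monomial_sumsI[of "K \<union> L" c] K(1) L(1) c by simp
qed

lemma scale_mem_monomial_sums:
  assumes "F \<in> monomial_sums"
  shows "(\<lambda>p. c * F p) \<in> monomial_sums"
proof -
  obtain K a where K: "finite K" "\<And>k. smooth_on_interval I (a k)"
    and F: "F = (\<lambda>p. \<Sum>k\<in>K. monomial k (a k) p)"
    using assms unfolding monomial_sums_def by blast
  have "(\<lambda>p. c * F p) = (\<lambda>p. \<Sum>k\<in>K. monomial k (\<lambda>x. c * a k x) p)"
    by (auto simp: F sum_distrib_left monomial_def fun_eq_iff intro!: sum.cong)
  then show ?thesis
    using monomial_sumsI[of K "\<lambda>k x. c * a k x"] K smooth_on_interval_mult[OF smooth_on_interval_const]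
    by simp
qed

lemma sum_mem_monomial_sums:
  "(\<And>k. k \<in> K \<Longrightarrow> F k \<in> monomial_sums) \<Longrightarrow> (\<lambda>p. \<Sum>k\<in>K. F k p) \<in> monomial_sums"
  by (induction K rule: infinite_finite_induct)
     (auto intro: zero_mem_monomial_sums add_mem_monomial_sums)

lemma poisson_bracket_mem_monomial_sums:
  assumes "F \<in> monomial_sums" "G \<in> monomial_sums"
  shows "poisson_bracket I q \<sigma> F G \<in> monomial_sums"
proof -
  obtain K a where K: "finite K" "\<And>k. smooth_on_interval I (a k)"
    and F: "F = (\<lambda>p. \<Sum>k\<in>K. monomial k (a k) p)"
    using assms(1) unfolding monomial_sums_def by blast
  obtain L b where L: "finite L" "\<And>l. smooth_on_interval I (b l)"
    and G: "G = (\<lambda>p. \<Sum>l\<in>L. monomial l (b l) p)"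
    using assms(2) unfolding monomial_sums_def by blast
  obtain a' where a': "\<And>k. smooth_on_interval I (a' k)" "\<And>k. arclength_derivative (a k) (a' k)"
    using smooth_family_has_arclength_derivatives[of a, OF K(2)] by blast
  obtain b' where b': "\<And>l. smooth_on_interval I (b' l)" "\<And>l. arclength_derivative (b l) (b' l)"
    using smooth_family_has_arclength_derivatives[of b, OF L(2)] by blast
  show ?thesis
    unfolding F G poisson_bracket_sum_monomial[OF a'(2) b'(2)]
    by (intro sum_mem_monomial_sums add_mem_monomial_sums monomial_mem_monomial_sums
          smooth_on_interval_mult smooth_on_interval_const K(2) L(2) a'(1) b'(1))
qed

text \<open>
  For \<open>l = 0\<close>, \<open>b = 1\<close> and \<open>b' = 0\<close> only the last of the four terms of the general formula survives, with
  coefficient \<open>1 - l = 1\<close>. This raises the degree by one.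
\<close>
lemma poisson_bracket_monomial_one:
  assumes "arclength_derivative f h"
  shows "poisson_bracket I q \<sigma> (monomial k f) (monomial 0 (\<lambda>x. 1)) = monomial (Suc k) h"
proof -
  have "arclength_derivative (\<lambda>x. 1) (\<lambda>x. 0)" by (simp add: arclength_derivative_def)
  then show ?thesis
    using poisson_bracket_sum_monomial[of "{k}" "\<lambda>_. f" "\<lambda>_. h" "{0}" "\<lambda>_ x. 1" "\<lambda>_ x. 0"] assms
    by (simp add: monomial_def fun_eq_iff)
qed

text \<open>
  In degree \<open>0\<close> the monomials are the generators up to the factor \<open>-2\<close>. A monomial of degree \<open>k + 1\<close>
  with coefficient \<open>h\<close> is the bracket of one of degree \<open>k\<close>, whose coefficient is an antiderivative of
  \<open>h\<close> in arc length, with the monomial of degree \<open>0\<close> and coefficient \<open>1\<close>.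
\<close>
lemma monomial_mem_lie_algebra:
  "smooth_on_interval I h \<Longrightarrow> monomial k h \<in> lie_algebra_H I q \<sigma>"
proof (induction k arbitrary: h)
  case 0
  have "smooth_on_interval I (\<lambda>x. - 1 / 2 * h x)"
    by (intro smooth_on_interval_mult smooth_on_interval_const 0)
  then have "hamiltonian I q (\<lambda>x. - 1 / 2 * h x) \<in> lie_algebra_H I q \<sigma>"
    unfolding lie_algebra_H_def by (blast intro: lie_algebra_generated.generator)
  then show ?case by (simp add: hamiltonian_eq_monomial)
next
  case (Suc k)
  have one: "monomial 0 (\<lambda>x. 1) \<in> lie_algebra_H I q \<sigma>"
  proof -
    have "hamiltonian I q (\<lambda>x. - 1 / 2) \<in> lie_algebra_H I q \<sigma>"
      unfolding lie_algebra_H_def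
      using smooth_on_interval_const by (blast intro: lie_algebra_generated.generator)
    then show ?thesis by (simp add: hamiltonian_eq_monomial)
  qed
  obtain f where f: "smooth_on_interval I f" "arclength_derivative f h"
    by (rule smooth_is_arclength_derivative[OF Suc.prems])
  have "poisson_bracket I q \<sigma> (monomial k f) (monomial 0 (\<lambda>x. 1)) \<in> lie_algebra_H I q \<sigma>"
    using lie_algebra_generated.bracket Suc.IH[OF f(1)] one unfolding lie_algebra_H_def .
  then show ?case by (simp add: poisson_bracket_monomial_one[OF f(2)])
qed

lemma lie_algebra_eq_monomial_sums: "lie_algebra_H I q \<sigma> = monomial_sums"
proof
  have "F \<in> monomial_sums" if "F \<in> lie_algebra_H I q \<sigma>" for F
    using that unfolding lie_algebra_H_def
  proof induction
    case (generator F)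
    then obtain f where f: "smooth_on_interval I f" "F = hamiltonian I q f" by blast
    show ?case
      unfolding f(2) hamiltonian_eq_monomial
      by (intro monomial_mem_monomial_sums smooth_on_interval_mult smooth_on_interval_const f(1))
  qed (auto intro: zero_mem_monomial_sums add_mem_monomial_sums scale_mem_monomial_sums
        poisson_bracket_mem_monomial_sums)
  then show "lie_algebra_H I q \<sigma> \<subseteq> monomial_sums" ..
next
  show "monomial_sums \<subseteq> lie_algebra_H I q \<sigma>"
  proof
    fix F assume "F \<in> monomial_sums"
    then obtain K a where K: "finite K" "\<And>k. smooth_on_interval I (a k)"
      and F: "F = (\<lambda>p. \<Sum>k\<in>K. monomial k (a k) p)"
      unfolding monomial_sums_def by blast
    show "F \<in> lie_algebra_H I q \<sigma>"
      unfolding F using K(1)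
    proof induction
      case empty
      then show ?case by (simp add: lie_algebra_H_def lie_algebra_generated.zero)
    next
      case (insert k K)
      then show ?case
        using monomial_mem_lie_algebra[OF K(2)]
        by (simp add: lie_algebra_H_def lie_algebra_generated.add)
    qed
  qed
qed

section \<open>The direct sum\<close>

lemma linear_subspace_Lambda: "linear_subspace (Lambda I \<sigma> k)"
  unfolding linear_subspace_def
proof (intro conjI ballI allI)
  have "(\<lambda>p. 0) = H_sy I \<sigma> k (\<lambda>x. 0)" by (auto simp: H_sy_def)
  then show "(\<lambda>p. 0) \<in> Lambda I \<sigma> k"
    unfolding Lambda_def using smooth_on_interval_const by blast
next
  fix F G assume "F \<in> Lambda I \<sigma> k" "G \<in> Lambda I \<sigma> k"
  then obtain f g where fg: "smooth_on_interval I f" "smooth_on_interval I g"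
    "F = H_sy I \<sigma> k f" "G = H_sy I \<sigma> k g" unfolding Lambda_def by blast
  then have "(\<lambda>p. F p + G p) = H_sy I \<sigma> k (\<lambda>x. f x + g x)"
    by (auto simp: H_sy_def fun_eq_iff add_divide_distrib algebra_simps)
  then show "(\<lambda>p. F p + G p) \<in> Lambda I \<sigma> k"
    unfolding Lambda_def using smooth_on_interval_add[OF fg(1,2)] by blast
next
  fix F c assume "F \<in> Lambda I \<sigma> k"
  then obtain f where f: "smooth_on_interval I f" "F = H_sy I \<sigma> k f"
    unfolding Lambda_def by blast
  then have "(\<lambda>p. c * F p) = H_sy I \<sigma> k (\<lambda>x. c * f x)"
    by (auto simp: H_sy_def fun_eq_iff)
  then show "(\<lambda>p. c * F p) \<in> Lambda I \<sigma> k"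
    unfolding Lambda_def
    using smooth_on_interval_mult[OF smooth_on_interval_const f(1)] by blast
qed

lemma in_sy_coords_sum:
  "in_sy_coords I q \<sigma> (\<lambda>p. \<Sum>k\<in>K. monomial k (a k) p) = (\<lambda>p. \<Sum>k\<in>K. H_sy I \<sigma> k (a k) p)"
  unfolding in_sy_coords_monomial[symmetric] by (auto simp: in_sy_coords_def fun_eq_iff)

lemma lie_algebra_in_sy_coords:
  "in_sy_coords I q \<sigma> ` lie_algebra_H I q \<sigma> =
     {\<lambda>p. \<Sum>k\<in>K. u k p | K u. finite K \<and> (\<forall>k\<in>K. u k \<in> Lambda I \<sigma> k)}" (is "_ = ?S")
proof
  show "in_sy_coords I q \<sigma> ` lie_algebra_H I q \<sigma> \<subseteq> ?S"
  proof
    fix F assume "F \<in> in_sy_coords I q \<sigma> ` lie_algebra_H I q \<sigma>"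
    then obtain K a where K: "finite K" "\<And>k. smooth_on_interval I (a k)"
      and "F = in_sy_coords I q \<sigma> (\<lambda>p. \<Sum>k\<in>K. monomial k (a k) p)"
      unfolding lie_algebra_eq_monomial_sums monomial_sums_def by blast
    then have F: "F = (\<lambda>p. \<Sum>k\<in>K. H_sy I \<sigma> k (a k) p)"
      by (simp add: in_sy_coords_sum)
    have "\<forall>k\<in>K. H_sy I \<sigma> k (a k) \<in> Lambda I \<sigma> k"
      using K(2) unfolding Lambda_def by blast
    then show "F \<in> ?S"
      unfolding F mem_Collect_eq
      by (intro exI[of _ K] exI[of _ "\<lambda>k. H_sy I \<sigma> k (a k)"]) (simp add: K(1))
  qed
next
  show "?S \<subseteq> in_sy_coords I q \<sigma> ` lie_algebra_H I q \<sigma>"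
  proof
    fix F assume "F \<in> ?S"
    then obtain K u where K: "finite K" "\<forall>k\<in>K. u k \<in> Lambda I \<sigma> k" and F: "F = (\<lambda>p. \<Sum>k\<in>K. u k p)"
      by blast
    have "\<exists>h. smooth_on_interval I h \<and> (k \<in> K \<longrightarrow> u k = H_sy I \<sigma> k h)" for k
      using K(2) smooth_on_interval_const unfolding Lambda_def by (cases "k \<in> K") blast+
    then have "\<forall>k. \<exists>h. smooth_on_interval I h \<and> (k \<in> K \<longrightarrow> u k = H_sy I \<sigma> k h)" ..
    then have "\<exists>a. \<forall>k. smooth_on_interval I (a k) \<and> (k \<in> K \<longrightarrow> u k = H_sy I \<sigma> k (a k))"
      by (rule choice)
    then obtain a where a: "\<And>k. smooth_on_interval I (a k)" "\<And>k. k \<in> K \<Longrightarrow> u k = H_sy I \<sigma> k (a k)"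
      by blast
    have eq: "F = in_sy_coords I q \<sigma> (\<lambda>p. \<Sum>k\<in>K. monomial k (a k) p)"
      unfolding F in_sy_coords_sum by (intro ext sum.cong) (simp_all add: a(2))
    show "F \<in> in_sy_coords I q \<sigma> ` lie_algebra_H I q \<sigma>"
      unfolding eq lie_algebra_eq_monomial_sums by (intro imageI monomial_sumsI K(1) a(1))
  qed
qed

text \<open>
  At a fixed point of the base, multiplying the relation by \<open>sqrt (1 + y\<^sup>2)\<close> gives a polynomial in \<open>y\<close>
  that vanishes for all \<open>y\<close>, so all its coefficients are \<open>0\<close>.
\<close>
lemma Lambda_independent:
  assumes K: "finite K" "\<forall>k\<in>K. u k \<in> Lambda I \<sigma> k"
    and zero: "(\<lambda>p. \<Sum>k\<in>K. u k p) = (\<lambda>p. 0)"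
  shows "\<forall>k\<in>K. u k = (\<lambda>p. 0)"
proof -
  have "\<forall>k\<in>K. \<exists>f. u k = H_sy I \<sigma> k f"
    using K(2) unfolding Lambda_def by blast
  then have "\<exists>h. \<forall>k\<in>K. u k = H_sy I \<sigma> k (h k)"
    by (rule bchoice)
  then obtain h where h: "\<forall>k\<in>K. u k = H_sy I \<sigma> k (h k)" ..
  define N where "N = Max K"
  have N: "k \<le> N" if "k \<in> K" for k
    unfolding N_def using K(1) that by (rule Max_ge)
  have coeff: "h k x = 0" if k: "k \<in> K" and x: "x \<in> I" for k x
  proof -
    have "(\<Sum>i\<le>N. (if i \<in> K then h i x else 0) * y ^ i) = 0" for y
    proof -
      have pos: "sqrt (1 + y\<^sup>2) > 0" by (simp add: add_pos_nonneg)
      have "(\<Sum>k\<in>K. h k x * y ^ k) / sqrt (1 + y\<^sup>2) = (\<Sum>k\<in>K. u k (\<sigma> x, y))"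
        using x by (simp add: h H_sy_def sum_divide_distrib)
      also have "\<dots> = 0" using fun_cong[OF zero, of "(\<sigma> x, y)"] by simp
      finally have "(\<Sum>k\<in>K. h k x * y ^ k) = 0" using pos by simp
      moreover have "(\<Sum>i\<le>N. (if i \<in> K then h i x else 0) * y ^ i) = (\<Sum>k\<in>K. h k x * y ^ k)"
        by (rule sum.mono_neutral_cong_right) (use N in auto)
      ultimately show ?thesis by simp
    qed
    then have "\<forall>i\<le>N. (if i \<in> K then h i x else 0) = 0"
      by (subst polyfun_eq_0[symmetric]) simp
    then have "(if k \<in> K then h k x else 0) = 0"
      using N[OF k] by blast
    then show ?thesis using k by simp
  qed
  have "u k p = 0" if "k \<in> K" for k p
    using bspec[OF h that] coeff[OF that] by (auto simp: H_sy_def inv_into_into split: prod.splits)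
  then show ?thesis by blast
qed

end

theorem theorem1p21:
  fixes I :: "real set" and q \<sigma> :: "real \<Rightarrow> real"
  assumes "nondegenerate_interval I"
    and "riemannian_metric I q"
    and "natural_parameter I q \<sigma>"
  shows "is_direct_sum (in_sy_coords I q \<sigma> ` lie_algebra_H I q \<sigma>) (Lambda I \<sigma>)"
proof -
  interpret metric_interval I q \<sigma> using assms by unfold_locales
  show ?thesis
    unfolding is_direct_sum_def
    using linear_subspace_Lambda lie_algebra_in_sy_coords Lambda_independent by blast
qed

end
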